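(* $q(4) = 9$, where for a positive integer $k$, $q(k)$ denotes the smallest integer $n$ such that there exists an intersecting $k$-family of transversal size $k$ and length $n$.
   Context: A $k$-set is a set with $k$ elements. A $k$-family is a collection of $k$-sets; its members are called blocks, and its length (or size) is the number of blocks in it. A $k$-family $\mathcal{F}$ is intersecting if $F \cap G \neq \emptyset$ for all $F, G \in \mathcal{F}$. A set $C$ is a covering set of $\mathcal{F}$ if $C \cap F \neq \emptyset$ for all $F \in \mathcal{F}$. The transversal size of $\mathcal{F}$ is the smallest integer $t$ such that there exists a covering set of $\mathcal{F}$ with exactly $t$ elements. *)

theory Defs
  imports Main
begin

definition k_set :: "nat \<Rightarrow> 'a set \<Rightarrow> bool" where
  "k_set k A \<longleftrightarrow> finite A \<and> card A = k"

definition k_family :: "nat \<Rightarrow> 'a set set \<Rightarrow> bool" where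
  "k_family k \<F> \<longleftrightarrow> (\<forall>F\<in>\<F>. k_set k F)"

definition has_length :: "'a set set \<Rightarrow> nat \<Rightarrow> bool" where
  "has_length \<F> n \<longleftrightarrow> finite \<F> \<and> card \<F> = n"

definition intersecting :: "'a set set \<Rightarrow> bool" where
  "intersecting \<F> \<longleftrightarrow> (\<forall>F\<in>\<F>. \<forall>G\<in>\<F>. F \<inter> G \<noteq> {})"

definition covering_set :: "'a set set \<Rightarrow> 'a set \<Rightarrow> bool" where
  "covering_set \<F> C \<longleftrightarrow> (\<forall>F\<in>\<F>. C \<inter> F \<noteq> {})"

definition transversal_size :: "'a set set \<Rightarrow> nat" where
  "transversal_size \<F> = (LEAST t. \<exists>C. k_set t C \<and> covering_set \<F> C)"

text \<open>Points are taken to be natural numbers. Since only families with finitely many finite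
  blocks are involved, this is no restriction; see \<open>q_witness_transfer\<close> below.\<close>

definition q :: "nat \<Rightarrow> nat" where
  "q k = (LEAST n. \<exists>\<F> :: nat set set. k_family k \<F> \<and> intersecting \<F> \<and>
            transversal_size \<F> = k \<and> has_length \<F> n)"

lemma transversal_size_le:
  assumes "finite C" "covering_set \<F> C"
  shows "transversal_size \<F> \<le> card C"
  unfolding transversal_size_def
  by (rule Least_le) (use assms in \<open>auto simp: k_set_def\<close>)

lemma transversal_size_witness:
  assumes "finite C" "covering_set \<F> C"
  obtains D where "finite D" "covering_set \<F> D" "card D = transversal_size \<F>"
proof -
  have "\<exists>D. k_set (transversal_size \<F>) D \<and> covering_set \<F> D"
    unfolding transversal_size_def
    by (rule LeastI[of _ "card C"]) (use assms in \<open>auto simp: k_set_def\<close>)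
  then show ?thesis using that by (auto simp: k_set_def)
qed

lemma q_witness_transfer:
  fixes \<F> :: "'a set set"
  assumes k: "0 < k" and fam: "k_family k \<F>" and int: "intersecting \<F>"
    and tr: "transversal_size \<F> = k" and len: "has_length \<F> n"
  shows "\<exists>\<G> :: nat set set. k_family k \<G> \<and> intersecting \<G> \<and>
           transversal_size \<G> = k \<and> has_length \<G> n"
proof -
  define U where "U = \<Union>\<F>"
  have finU: "finite U"
    using fam len by (auto simp: U_def k_family_def k_set_def has_length_def)
  then obtain h :: "'a \<Rightarrow> nat" where h: "inj_on h U"
    using finite_imp_inj_to_nat_seg by blast
  have sub: "F \<subseteq> U" if "F \<in> \<F>" for F using that by (auto simp: U_def)
  define \<G> where "\<G> = (`) h ` \<F>"
  have inj: "inj_on ((`) h) \<F>"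
    by (rule inj_on_subset[OF inj_on_image_Pow[OF h]]) (use sub in auto)
  have fam': "k_family k \<G>"
    unfolding k_family_def \<G>_def
  proof
    fix G assume "G \<in> (`) h ` \<F>"
    then obtain F where F: "F \<in> \<F>" "G = h ` F" by auto
    have "card G = card F" using F(2) card_image[OF inj_on_subset[OF h sub[OF F(1)]]] by simp
    then show "k_set k G" using fam F by (simp add: k_family_def k_set_def)
  qed
  have len': "has_length \<G> n"
    using len inj by (auto simp: \<G>_def has_length_def card_image)
  have int': "intersecting \<G>"
    using int by (fastforce simp: intersecting_def \<G>_def)
  have ne: "F \<noteq> {}" if "F \<in> \<F>" for F
    using that fam k by (auto simp: k_family_def k_set_def)
  have covU: "covering_set \<F> U"
    using sub ne by (simp add: covering_set_def Int_absorb1)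
  have covhU: "covering_set \<G> (h ` U)"
    using sub ne by (simp add: covering_set_def \<G>_def image_mono Int_absorb1)
  obtain C where C: "finite C" "covering_set \<F> C" "card C = transversal_size \<F>"
    using transversal_size_witness[OF finU covU] .
  have "covering_set \<G> (h ` C)"
    using C(2) by (fastforce simp: covering_set_def \<G>_def)
  then have le1: "transversal_size \<G> \<le> transversal_size \<F>"
    using transversal_size_le[of "h ` C" \<G>] C card_image_le[of C h] by simp
  obtain D where D: "finite D" "covering_set \<G> D" "card D = transversal_size \<G>"
    using transversal_size_witness[OF _ covhU] finU by auto
  define E where "E = {x\<in>U. h x \<in> D}"
  have "finite E" using finU by (simp add: E_def)
  moreover have "covering_set \<F> E"
    unfolding covering_set_def
  proof
    fix F assume F: "F \<in> \<F>"
    then have "D \<inter> h ` F \<noteq> {}" using D(2) by (auto simp: covering_set_def \<G>_def)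
    then show "E \<inter> F \<noteq> {}" using sub[OF F] by (auto simp: E_def)
  qed
  ultimately have "transversal_size \<F> \<le> card E" by (rule transversal_size_le)
  also have "card E \<le> card D"
    by (rule card_inj_on_le[of h]) (use h D in \<open>auto simp: E_def inj_on_def\<close>)
  finally have "transversal_size \<G> = k" using le1 D tr by simp
  with fam' int' len' show ?thesis by blast
qed

end

theory Submission imports Defs begin

text \<open>Lower bound: in an intersecting family, \<open>2m\<close> blocks can always be covered by \<open>m\<close> points,
  so in a 4-family with \<open>n \<le> 8\<close> blocks and transversal size 4 every point has degree at most
  \<open>n - 5\<close>. The degrees along a block sum to at least \<open>n + 3\<close>, which forces \<open>n = 8\<close>, maximal degree 3,
  and at least three points of degree 3 on every block. Moreover any two points of degree 3 share a
  block, since otherwise they cover six blocks and a third point covers the other two. Let \<open>a\<close> be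
  the number of points of degree 3 and \<open>m\<^sub>F \<in> {3, 4}\<close> their number on \<open>F\<close>. Then \<open>\<Sum> m\<^sub>F = 3 a\<close> and,
  counting pairs, \<open>\<Sum> m\<^sub>F\<^sup>2 \<ge> 3 a + a (a - 1)\<close>, while \<open>m\<^sub>F\<^sup>2 \<le> 7 m\<^sub>F - 12\<close>. Hence
  \<open>a\<^sup>2 + 96 \<le> 19 a\<close>, which is impossible.\<close>

definition degree :: "'a set set \<Rightarrow> 'a \<Rightarrow> nat" where
  "degree \<F> x = card {F\<in>\<F>. x \<in> F}"

text \<open>Pair up the blocks and choose one common point for each pair.\<close>

lemma intersecting_covered_by_half:
  assumes "finite \<F>" "intersecting \<F>" "card \<F> \<le> 2 * m"
  shows "\<exists>C. finite C \<and> card C \<le> m \<and> covering_set \<F> C"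
  using assms
proof (induction m arbitrary: \<F>)
  case 0
  then show ?case by (intro exI[of _ "{}"]) (auto simp: covering_set_def)
next
  case (Suc m)
  show ?case
  proof (cases "\<F> = {}")
    case True
    then show ?thesis by (intro exI[of _ "{}"]) (auto simp: covering_set_def)
  next
    case False
    then obtain F where F: "F \<in> \<F>" by blast
    obtain G where G: "G \<in> \<F>" "card (\<F> - {F, G}) \<le> 2 * m"
    proof (cases "\<F> = {F}")
      case True
      \<comment> \<open>A lone block is paired with itself; \<open>intersecting\<close> for equal
        blocks says it is nonempty, so a common point still exists.\<close>
      then show ?thesis using that[of F] by simp
    next
      case False
      then obtain G where "G \<in> \<F>" "G \<noteq> F" using F by blast
      moreover from this have "card (\<F> - {F, G}) = card \<F> - 2"
        using F by (subst card_Diff_subset) auto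
      ultimately show ?thesis using that[of G] Suc.prems(3) by simp
    qed
    obtain x where x: "x \<in> F" "x \<in> G"
      using Suc.prems(2) F G(1) unfolding intersecting_def by blast
    have "intersecting (\<F> - {F, G})"
      using Suc.prems(2) by (auto simp: intersecting_def)
    then obtain C where C: "finite C" "card C \<le> m" "covering_set (\<F> - {F, G}) C"
      using Suc.IH[of "\<F> - {F, G}"] Suc.prems(1) G(2) by auto
    have "covering_set \<F> (insert x C)"
      unfolding covering_set_def
    proof
      fix H assume "H \<in> \<F>"
      then show "insert x C \<inter> H \<noteq> {}"
        using C(3) x by (cases "H \<in> {F, G}") (auto simp: covering_set_def)
    qed
    moreover have "card (insert x C) \<le> Suc m"
      using C by (simp add: card_insert_if)
    ultimately show ?thesis using C(1) by blast
  qed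
qed

text \<open>Used contrapositively: with transversal size 4, any c <= 3 points miss more than 2 (3 -
  c) blocks.\<close>

lemma transversal_size_le_residual:
  assumes "finite \<F>" "intersecting \<F>" "finite C" "card {F\<in>\<F>. C \<inter> F = {}} \<le> 2 * m"
  shows "transversal_size \<F> \<le> card C + m"
proof -
  have "intersecting {F\<in>\<F>. C \<inter> F = {}}"
    using assms(2) by (auto simp: intersecting_def)
  then obtain D where D: "finite D" "card D \<le> m" "covering_set {F\<in>\<F>. C \<inter> F = {}} D"
    using intersecting_covered_by_half[of "{F\<in>\<F>. C \<inter> F = {}}" m] assms by auto
  have "covering_set \<F> (C \<union> D)"
    using D(3) by (fastforce simp: covering_set_def)
  then have "transversal_size \<F> \<le> card (C \<union> D)"
    using assms(3) D(1) by (intro transversal_size_le) auto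
  also have "\<dots> \<le> card C + m"
    using card_Un_le[of C D] D(2) by linarith
  finally show ?thesis .
qed

lemma sum_degree:
  assumes "finite \<F>" "finite A"
  shows "(\<Sum>x\<in>A. degree \<F> x) = (\<Sum>F\<in>\<F>. card (A \<inter> F))"
proof -
  have "(\<Sum>x\<in>A. degree \<F> x) = (\<Sum>x\<in>A. \<Sum>F\<in>\<F>. if x \<in> F then 1 else 0)"
    unfolding degree_def using assms by (simp add: sum.If_cases Int_def)
  also have "\<dots> = (\<Sum>F\<in>\<F>. \<Sum>x\<in>A. if x \<in> F then 1 else 0)"
    by (rule sum.swap)
  also have "\<dots> = (\<Sum>F\<in>\<F>. card (A \<inter> F))"
    using assms by (simp add: sum.If_cases)
  finally show ?thesis .
qed

text \<open>Both points of (x, y) lie in \<open>F\<close> iff (x, y) lies in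
  \<open>F \<times> F\<close>, so this is \<open>sum_degree\<close> for the squares of the blocks on
  the point set \<open>A \<times> A\<close>. Pairs are ordered and include the diagonal.\<close>

lemma sum_codegree:
  assumes "finite \<F>" "finite A"
  shows "(\<Sum>x\<in>A. \<Sum>y\<in>A. card {F\<in>\<F>. x \<in> F \<and> y \<in> F}) = (\<Sum>F\<in>\<F>. card (A \<inter> F) ^ 2)"
proof -
  have "(\<Sum>x\<in>A. \<Sum>y\<in>A. card {F\<in>\<F>. x \<in> F \<and> y \<in> F}) =
      (\<Sum>p\<in>A \<times> A. degree ((\<lambda>F. F \<times> F) ` \<F>) p)"
  proof -
    have "card {F\<in>\<F>. x \<in> F \<and> y \<in> F} = degree ((\<lambda>F. F \<times> F) ` \<F>) (x, y)" for x y
    proof -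
      have "{G \<in> (\<lambda>F. F \<times> F) ` \<F>. (x, y) \<in> G} = (\<lambda>F. F \<times> F) ` {F\<in>\<F>. x \<in> F \<and> y \<in> F}"
        by auto
      moreover have "inj_on (\<lambda>F. F \<times> F) {F\<in>\<F>. x \<in> F \<and> y \<in> F}"
        by (auto simp: inj_on_def)
      ultimately show ?thesis by (simp add: degree_def card_image)
    qed
    then show ?thesis by (simp add: sum.cartesian_product)
  qed
  also have "\<dots> = (\<Sum>G\<in>(\<lambda>F. F \<times> F) ` \<F>. card (A \<times> A \<inter> G))"
    using assms by (intro sum_degree) auto
  also have "\<dots> = (\<Sum>F\<in>\<F>. card (A \<times> A \<inter> F \<times> F))"
    by (rule sum.reindex_cong[of "\<lambda>F. F \<times> F"]) (auto simp: inj_on_def)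
  also have "\<dots> = (\<Sum>F\<in>\<F>. card (A \<inter> F) ^ 2)"
    by (simp add: Times_Int_Times power2_eq_square card_cartesian_product)
  finally show ?thesis .
qed

text \<open>Counted by blocks, the degree sum receives \<open>card F\<close> from \<open>F\<close>
  itself and at least 1 from each other block, since that block meets \<open>F\<close>.\<close>

lemma sum_degree_block_ge:
  assumes "finite \<F>" "intersecting \<F>" "F \<in> \<F>" "finite F"
  shows "card F + card \<F> \<le> (\<Sum>x\<in>F. degree \<F> x) + 1"
proof -
  have "card (\<F> - {F}) \<le> (\<Sum>G\<in>\<F> - {F}. card (F \<inter> G))"
  proof -
    have "1 \<le> card (F \<inter> G)" if "G \<in> \<F> - {F}" for G
      using assms that by (auto simp: intersecting_def Suc_le_eq card_gt_0_iff)
    then have "(\<Sum>G\<in>\<F> - {F}. 1) \<le> (\<Sum>G\<in>\<F> - {F}. card (F \<inter> G))"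
      by (rule sum_mono)
    then show ?thesis by simp
  qed
  moreover have "(\<Sum>x\<in>F. degree \<F> x) = card F + (\<Sum>G\<in>\<F> - {F}. card (F \<inter> G))"
    using assms by (simp add: sum_degree sum.remove[of \<F> F])
  moreover have "card \<F> = card (\<F> - {F}) + 1"
    using assms by (metis Suc_eq_plus1 card_Suc_Diff1)
  ultimately show ?thesis by simp
qed

lemma length_ge_9_if_transversal_size_4:
  assumes fam: "k_family 4 \<F>" and int: "intersecting \<F>"
    and tr: "transversal_size \<F> = 4" and len: "has_length \<F> n"
  shows "9 \<le> n"
proof (rule ccontr)
  assume "\<not> 9 \<le> n"
  then have n: "card \<F> \<le> 8" and fin: "finite \<F>"
    using len by (auto simp: has_length_def)
  have block: "finite F" "card F = 4" if "F \<in> \<F>" for F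
    using fam that by (auto simp: k_family_def k_set_def)
  have split: "card \<F> = card {F\<in>\<F>. C \<inter> F = {}} + card {F\<in>\<F>. C \<inter> F \<noteq> {}}" for C
    using fin by (subst card_Un_disjoint[symmetric]) (auto intro!: arg_cong[of _ _ card])
  have degree_le: "degree \<F> x + 5 \<le> card \<F>" for x
  proof -
    have "\<not> card {F\<in>\<F>. {x} \<inter> F = {}} \<le> 2 * 2"
      using transversal_size_le_residual[OF fin int, of "{x}" 2] tr by auto
    moreover have "{F\<in>\<F>. {x} \<inter> F \<noteq> {}} = {F\<in>\<F>. x \<in> F}" by auto
    ultimately show ?thesis using split[of "{x}"] by (simp add: degree_def)
  qed
  have sum_ge: "card \<F> + 3 \<le> (\<Sum>x\<in>F. degree \<F> x)" if "F \<in> \<F>" for F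
    using sum_degree_block_ge[OF fin int that] block[OF that] by simp
  have n8: "card \<F> = 8"
  proof -
    have "\<F> \<noteq> {}"
      using transversal_size_le_residual[of \<F> "{}" 0] tr by (auto simp: intersecting_def)
    then obtain F where F: "F \<in> \<F>" by blast
    \<comment> \<open>With n blocks this gives n + 3 + 20 <= 4 n, hence n >= 8.\<close>
    have "(\<Sum>x\<in>F. degree \<F> x + 5) \<le> (\<Sum>x\<in>F. card \<F>)"
      by (intro sum_mono degree_le)
    then show ?thesis
      using sum_ge[OF F] block[OF F] n by (simp add: sum.distrib)
  qed
  have deg3: "degree \<F> x \<le> 3" for x using degree_le[of x] n8 by simp
  define A where "A = {x \<in> \<Union>\<F>. degree \<F> x = 3}"
  define m where "m F = card (A \<inter> F)" for F
  have finA: "finite A" unfolding A_def using fin block by auto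
  \<comment> \<open>Equivalent to (m - 3)(m - 4) <= 0: a linear bound on the square, exact at both
    possible values 3 and 4.\<close>
  have m: "m F ^ 2 + 12 \<le> 7 * m F" if F: "F \<in> \<F>" for F
  proof -
    have "11 \<le> (\<Sum>x\<in>F. degree \<F> x)" using sum_ge[OF F] n8 by simp
    also have "\<dots> \<le> (\<Sum>x\<in>F. 2 + (if x \<in> A then 1 else 0))"
    proof (rule sum_mono)
      fix x assume "x \<in> F"
      then show "degree \<F> x \<le> 2 + (if x \<in> A then 1 else 0)"
        using deg3[of x] F by (auto simp: A_def)
    qed
    also have "\<dots> = 8 + m F"
      using block[OF F] by (subst sum.distrib) (simp add: sum.If_cases m_def Int_commute)
    finally have "3 \<le> m F" by simp
    moreover have "m F \<le> 4"
      using card_mono[of F "A \<inter> F"] block[OF F] by (simp add: m_def)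
    ultimately have "m F = 3 \<or> m F = 4" by auto
    then show ?thesis by auto
  qed
  have codegree: "1 \<le> card {F\<in>\<F>. x \<in> F \<and> y \<in> F}" if "x \<in> A" "y \<in> A" "x \<noteq> y" for x y
  proof (rule ccontr)
    assume "\<not> 1 \<le> card {F\<in>\<F>. x \<in> F \<and> y \<in> F}"
    then have none: "{F\<in>\<F>. x \<in> F \<and> y \<in> F} = {}" using fin by (simp add: not_le)
    have "{F\<in>\<F>. {x, y} \<inter> F \<noteq> {}} = {F\<in>\<F>. x \<in> F} \<union> {F\<in>\<F>. y \<in> F}" by auto
    moreover have "card \<dots> = 6"
      using none that fin by (subst card_Un_disjoint) (auto simp: A_def degree_def)
    ultimately have "card {F\<in>\<F>. {x, y} \<inter> F = {}} \<le> 2 * 1"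
      using split[of "{x, y}"] n8 by simp
    then show False
      using transversal_size_le_residual[OF fin int, of "{x, y}" 1] tr that by simp
  qed
  \<comment> \<open>The diagonal term is the degree 3; each of the other \<open>card A - 1\<close>
    terms is at least 1.\<close>
  have row: "card A + 2 \<le> (\<Sum>y\<in>A. card {F\<in>\<F>. x \<in> F \<and> y \<in> F})" if x: "x \<in> A" for x
  proof -
    have "(\<Sum>y\<in>A - {x}. 1) \<le> (\<Sum>y\<in>A - {x}. card {F\<in>\<F>. x \<in> F \<and> y \<in> F})"
      by (rule sum_mono) (use codegree x in auto)
    moreover have "card {F\<in>\<F>. x \<in> F \<and> x \<in> F} = 3"
      using x by (simp add: A_def degree_def)
    moreover have "card A = card (A - {x}) + 1"
      using finA x by (metis Suc_eq_plus1 card_Suc_Diff1)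
    moreover have "(\<Sum>y\<in>A. card {F\<in>\<F>. x \<in> F \<and> y \<in> F}) =
        card {F\<in>\<F>. x \<in> F \<and> x \<in> F} + (\<Sum>y\<in>A - {x}. card {F\<in>\<F>. x \<in> F \<and> y \<in> F})"
      by (rule sum.remove[OF finA x])
    ultimately show ?thesis unfolding card_eq_sum[symmetric] by linarith
  qed
  have "card A * (card A + 2) \<le> (\<Sum>x\<in>A. \<Sum>y\<in>A. card {F\<in>\<F>. x \<in> F \<and> y \<in> F})"
    using sum_mono[of A "\<lambda>_. card A + 2", OF row] by simp
  also have "\<dots> = (\<Sum>F\<in>\<F>. m F ^ 2)"
    unfolding m_def by (rule sum_codegree[OF fin finA])
  finally have "card A * (card A + 2) + 96 \<le> (\<Sum>F\<in>\<F>. m F ^ 2 + 12)"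
    using n8 by (simp add: sum.distrib)
  also have "\<dots> \<le> (\<Sum>F\<in>\<F>. 7 * m F)" by (rule sum_mono) (rule m)
  also have "\<dots> = 21 * card A"
  proof -
    have "(\<Sum>F\<in>\<F>. m F) = (\<Sum>x\<in>A. degree \<F> x)"
      unfolding m_def by (rule sum_degree[OF fin finA, symmetric])
    also have "\<dots> = 3 * card A" by (simp add: A_def)
    finally show ?thesis by (simp add: sum_distrib_left[symmetric])
  qed
  finally have "int (card A * (card A + 2) + 96) \<le> int (21 * card A)"
    by (simp only: of_nat_le_iff)
  \<comment> \<open>Four times a^2 + 96 <= 19 a with the square completed, where 23 = 4 * 96 - 19^2;
    integers are used because 2 a - 19 may be negative.\<close>
  then have "(2 * int (card A) - 19) ^ 2 + 23 \<le> 0"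
    by (simp add: power2_eq_square algebra_simps)
  then show False using zero_le_power2[of "2 * int (card A) - 19"] by linarith
qed

text \<open>A cover must contain a point of the first block, so branching over its points decides whether
  \<open>k\<close> points suffice.\<close>

fun uncoverable :: "'a list list \<Rightarrow> nat \<Rightarrow> bool" where
  "uncoverable [] k = False"
| "uncoverable (F # Fs) 0 = True"
| "uncoverable (F # Fs) (Suc k) = (\<forall>x\<in>set F. uncoverable (filter (\<lambda>G. x \<notin> set G) Fs) k)"

text \<open>If \<open>x\<close> in \<open>C\<close> hits the first block, then
  \<open>C - {x}\<close> still covers the blocks avoiding \<open>x\<close>, and the branch at
  \<open>x\<close> bounds its size.\<close>

lemma uncoverable_less_card_cover:
  assumes "uncoverable Fs k" "finite C" "covering_set (set ` set Fs) C"
  shows "k < card C"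
  using assms
proof (induction Fs k arbitrary: C rule: uncoverable.induct)
  case (2 F Fs)
  then show ?case by (auto simp: covering_set_def card_gt_0_iff)
next
  case (3 F Fs k)
  then obtain x where x: "x \<in> C" "x \<in> set F" by (auto simp: covering_set_def)
  have "covering_set (set ` set (filter (\<lambda>G. x \<notin> set G) Fs)) (C - {x})"
    using 3(4) by (auto simp: covering_set_def)
  then have "k < card (C - {x})"
    using 3(1)[OF x(2), of "C - {x}"] 3(2,3) x(2) by simp
  then show ?case using x(1) 3(3) by (simp add: card_Diff_singleton)
qed simp

lemma ex_4_family_length_9:
  "\<exists>\<F> :: nat set set. k_family 4 \<F> \<and> intersecting \<F> \<and> transversal_size \<F> = 4 \<and> has_length \<F> 9"
proof -
  \<comment> \<open>Eleven points: 0, 3 and 7 have degree 4, the most that the degree bound n - 5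
    permits for n = 9, and the others have degree 3.\<close>
  define Fs :: "nat list list" where
    "Fs = [[0, 1, 8, 10], [0, 2, 3, 9], [0, 3, 5, 7], [0, 4, 6, 7], [1, 2, 7, 9],
           [1, 3, 4, 6], [2, 5, 6, 10], [3, 7, 8, 10], [4, 5, 8, 9]]"
  have fam: "k_family 4 (set ` set Fs)"
    by (simp add: Fs_def k_family_def k_set_def)
  have int: "intersecting (set ` set Fs)"
    by (simp add: Fs_def intersecting_def)
  \<comment> \<open>Different lists may have equal sets; sorting makes the comparison one of
    sets.\<close>
  have "distinct (map (\<lambda>F. sorted_list_of_set (set F)) Fs)"
    by (simp add: Fs_def)
  then have "distinct (map set Fs)"
    by (auto simp: distinct_map inj_on_def)
  then have len: "has_length (set ` set Fs) 9"
    using distinct_card[of "map set Fs"] by (simp add: has_length_def) (simp add: Fs_def)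
  have "uncoverable Fs 3"
    unfolding Fs_def by code_simp
  \<comment> \<open>In an intersecting family every block is a cover; the first one gives the upper
    bound 4.\<close>
  moreover have cov: "covering_set (set ` set Fs) {0, 1, 8, 10}"
    by (simp add: Fs_def covering_set_def)
  moreover obtain C where "finite C" "covering_set (set ` set Fs) C"
      "card C = transversal_size (set ` set Fs)"
    using transversal_size_witness[OF _ cov] by auto
  ultimately have "4 \<le> transversal_size (set ` set Fs)"
    using uncoverable_less_card_cover[of Fs 3 C] by simp
  moreover have "transversal_size (set ` set Fs) \<le> 4"
    using transversal_size_le[OF _ cov] by simp
  ultimately show ?thesis using fam int len by (intro exI[of _ "set ` set Fs"]) simp
qed

theorem theorem2p1: "q 4 = 9"
  unfolding q_def
  by (rule Least_equality)
    (use ex_4_family_length_9 length_ge_9_if_transversal_size_4 in blast)+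

end
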